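(* Let $G$ be a finite group with a subgroup $S$ of index $2$, let $H$ be a subgroup of $G$ with $|H| = w$, let $k,\lambda$ be positive integers, and let $X$ be a $(G,H,k,\lambda)$-relative difference family of size $n$. If $H$ is contained in $S$, then $kn-\lambda w$ is a sum of $n$ squares. If $H$ is not contained in $S$, then $kn$ is a sum of $n$ squares.
   Context: Let $H$ be a subgroup of a finite group $G$, written additively, and let $k$, $\lambda$ be positive integers. A $(G,H,k,\lambda)$-relative difference family is a collection $X=\{X_1,\dots,X_n\}$ of $k$-subsets of $G$ (called base blocks) whose list of differences, i.e. the multiset $\{x-y : x,y\in X_i,\ x\neq y,\ 1\le i\le n\}$, has no element in $H$ and covers every element of $G\setminus H$ exactly $\lambda$ times. Its size is the number $n$ of base blocks. Squares are squares of integers ($0$ allowed). *)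

theory Defs
  imports "HOL-Algebra.Coset" "HOL-Library.Multiset"
begin

(* The group is not assumed to be abelian and is written multiplicatively here,
   so the difference x - y is rendered as x \<otimes> inv y. *)
definition block_differences :: "('a, 'b) monoid_scheme \<Rightarrow> 'a set \<Rightarrow> 'a multiset" where
  "block_differences G B =
     image_mset (\<lambda>(x, y). x \<otimes>\<^bsub>G\<^esub> inv\<^bsub>G\<^esub> y)
       (mset_set {(x, y). x \<in> B \<and> y \<in> B \<and> x \<noteq> y})"

definition list_of_differences :: "('a, 'b) monoid_scheme \<Rightarrow> 'a set list \<Rightarrow> 'a multiset" where
  "list_of_differences G Xs = sum_list (map (block_differences G) Xs)"

(* The family is a list, so that base blocks may be repeated; its size is length Xs. *)
definition relative_difference_family ::
  "('a, 'b) monoid_scheme \<Rightarrow> 'a set \<Rightarrow> nat \<Rightarrow> nat \<Rightarrow> 'a set list \<Rightarrow> bool" where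
  "relative_difference_family G H k l Xs \<longleftrightarrow>
     (\<forall>B \<in> set Xs. B \<subseteq> carrier G \<and> card B = k) \<and>
     (\<forall>g \<in> H. g \<notin># list_of_differences G Xs) \<and>
     (\<forall>g \<in> carrier G - H. count (list_of_differences G Xs) g = l)"

definition is_sum_of_squares :: "nat \<Rightarrow> int \<Rightarrow> bool" where
  "is_sum_of_squares n z \<longleftrightarrow> (\<exists>a :: nat \<Rightarrow> int. z = (\<Sum>i<n. (a i)\<^sup>2))"

end

theory Submission imports Defs begin

text \<open>
  Since \<open>S\<close> has index 2, the function \<open>\<chi>\<close> that is \<open>1\<close> on \<open>S\<close> and \<open>-1\<close> off \<open>S\<close> satisfies
  \<open>\<chi> (x - y) = \<chi> x * \<chi> y\<close>. For a block \<open>B\<close> with \<open>k\<close> elements, expanding the square of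
  \<open>\<Sum>x\<in>B. \<chi> x\<close> therefore gives \<open>k\<close> from the diagonal plus the sum of \<open>\<chi>\<close> over the
  differences of \<open>B\<close>. Adding this up over all \<open>n\<close> blocks, and using that the differences
  cover \<open>G - H\<close> exactly \<open>l\<close> times and miss \<open>H\<close>, the sum of the \<open>n\<close> squares is
  \<open>k n + l ((\<Sum>g\<in>G. \<chi> g) - (\<Sum>h\<in>H. \<chi> h))\<close>.
  The sum of \<open>\<chi>\<close> over a subgroup not contained in \<open>S\<close> vanishes, because translation by an
  element outside \<open>S\<close> reverses its sign. In particular the sum over \<open>G\<close> is \<open>0\<close>, while the sum
  over \<open>H\<close> is \<open>w\<close> or \<open>0\<close> according to whether \<open>H\<close> is contained in \<open>S\<close>.
\<close>

text \<open>The sign character attached to \<open>S\<close>: the homomorphism onto \<open>{1, -1}\<close> with kernel \<open>S\<close>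
  when \<open>S\<close> is a subgroup of index 2.\<close>

definition sign_char :: "'a set \<Rightarrow> 'a \<Rightarrow> int" where
  "sign_char S x = (if x \<in> S then 1 else -1)"

lemma sum_image_mset_eq_sum_count:
  fixes f :: "'a \<Rightarrow> int"
  assumes "finite A" "set_mset M \<subseteq> A"
  shows "sum_mset (image_mset f M) = (\<Sum>a\<in>A. int (count M a) * f a)"
  using assms(2)
proof (induction M)
  case empty
  then show ?case by simp
next
  case (add x M)
  have "(\<Sum>a\<in>A. int (count (add_mset x M) a) * f a)
      = (\<Sum>a\<in>A. (if a = x then f a else 0) + int (count M a) * f a)"
    by (rule sum.cong) (auto simp: algebra_simps)
  also have "\<dots> = f x + (\<Sum>a\<in>A. int (count M a) * f a)"
    using add.prems assms(1) by (simp add: sum.distrib)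
  finally show ?case using add by simp
qed

context group
begin

lemma index_two_not_subset:
  assumes "subgroup S G" "card (rcosets S) = 2"
  shows "\<not> carrier G \<subseteq> S"
proof
  assume "carrier G \<subseteq> S"
  then have "rcosets S \<subseteq> {S}"
    using coset_join2[OF _ assms(1)] by (auto simp: RCOSETS_def)
  then have "card (rcosets S) \<le> 1"
    using card_mono[of "{S}"] by simp
  then show False using assms(2) by simp
qed

lemma index_two_diff_mem_iff:
  assumes S: "subgroup S G" and idx: "card (rcosets S) = 2"
    and x: "x \<in> carrier G" and y: "y \<in> carrier G"
  shows "x \<otimes> inv y \<in> S \<longleftrightarrow> (x \<in> S \<longleftrightarrow> y \<in> S)"
proof -
  have mem: "S #> z = S \<longleftrightarrow> z \<in> S" if "z \<in> carrier G" for z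
    using coset_join1[OF _ that S] coset_join2[OF that S] by blast
  have "S #> \<one> \<in> rcosets S" by (auto simp: RCOSETS_def)
  then have "S \<in> rcosets S"
    using coset_mult_one[OF subgroup.subset[OF S]] by simp
  moreover have "S #> x \<in> rcosets S" "S #> y \<in> rcosets S"
    using x y by (auto simp: RCOSETS_def)
  \<comment> \<open>\<open>S\<close> is one of the only two cosets, so all elements outside \<open>S\<close> share the other one.\<close>
  ultimately have "S #> x = S #> y \<longleftrightarrow> (x \<in> S \<longleftrightarrow> y \<in> S)"
    using idx mem[OF x] mem[OF y] unfolding card_2_iff by fastforce
  moreover have "S #> x = S #> y \<longleftrightarrow> x \<otimes> inv y \<in> S"
  proof
    assume "S #> x = S #> y"
    then have "S #> (x \<otimes> inv y) = S"
      using coset_mult_inv2[of S x y] x y subgroup.subset[OF S] by blast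
    then show "x \<otimes> inv y \<in> S" using mem x y by simp
  next
    assume "x \<otimes> inv y \<in> S"
    then have "S #> (x \<otimes> inv y) = S" using mem x y by simp
    then show "S #> x = S #> y"
      using coset_mult_inv1[of S x y] x y subgroup.subset[OF S] by blast
  qed
  ultimately show ?thesis by simp
qed

lemma sign_char_diff:
  assumes "subgroup S G" "card (rcosets S) = 2" "x \<in> carrier G" "y \<in> carrier G"
  shows "sign_char S (x \<otimes> inv y) = sign_char S x * sign_char S y"
  using index_two_diff_mem_iff[OF assms] by (auto simp: sign_char_def)

lemma sum_sign_char_subgroup:
  assumes S: "subgroup S G" "card (rcosets S) = 2"
    and K: "subgroup K G" "\<not> K \<subseteq> S"
  shows "(\<Sum>h\<in>K. sign_char S h) = 0"
proof -
  obtain t where t: "t \<in> K" "t \<notin> S" using K(2) by blast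
  note Kc = subgroup.mem_carrier[OF K(1)]
  have "(\<Sum>h\<in>K. sign_char S h) = (\<Sum>h\<in>K. sign_char S (h \<otimes> inv t))"
    by (rule sum.reindex_bij_witness[where i = "\<lambda>h. h \<otimes> inv t" and j = "\<lambda>h. h \<otimes> t"])
       (use t K(1) Kc in \<open>auto simp: m_assoc subgroup.m_closed subgroup.m_inv_closed\<close>)
  also have "\<dots> = (\<Sum>h\<in>K. - sign_char S h)"
    by (rule sum.cong) (use t Kc sign_char_diff[OF S] in \<open>auto simp: sign_char_def\<close>)
  finally show ?thesis by (simp add: sum_negf)
qed

lemma square_sum_sign_char:
  assumes S: "subgroup S G" "card (rcosets S) = 2"
    and B: "finite B" "B \<subseteq> carrier G"
  shows "(\<Sum>x\<in>B. sign_char S x)\<^sup>2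
       = int (card B) + sum_mset (image_mset (sign_char S) (block_differences G B))"
proof -
  let ?D = "{(x, y). x \<in> B \<and> y \<in> B \<and> x \<noteq> y}"
  let ?f = "\<lambda>(x, y). sign_char S x * sign_char S y"
  have BB: "B \<times> B = ?D \<union> (\<lambda>x. (x, x)) ` B" by auto
  have fin: "finite ?D" by (rule finite_subset[of _ "B \<times> B"]) (use B in auto)
  have "(\<Sum>x\<in>B. sign_char S x)\<^sup>2 = (\<Sum>p\<in>B \<times> B. ?f p)"
    by (simp add: power2_eq_square sum_product sum.cartesian_product)
  also have "\<dots> = (\<Sum>p\<in>?D. ?f p) + (\<Sum>p\<in>(\<lambda>x. (x, x)) ` B. ?f p)"
    unfolding BB by (rule sum.union_disjoint) (use fin B in auto)
  also have "(\<Sum>p\<in>(\<lambda>x. (x, x)) ` B. ?f p) = (\<Sum>x\<in>B. 1)"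
    unfolding sum.reindex[OF inj_onI[of B "\<lambda>x. (x, x)"], simplified]
    by (rule sum.cong) (auto simp: sign_char_def)
  also have "(\<Sum>p\<in>?D. ?f p) = (\<Sum>p\<in>?D. sign_char S (case p of (x, y) \<Rightarrow> x \<otimes> inv y))"
    by (rule sum.cong) (use B(2) in \<open>auto simp: sign_char_diff[OF S] subset_iff\<close>)
  also have "\<dots> = sum_mset (image_mset (sign_char S) (block_differences G B))"
    by (simp add: block_differences_def sum_unfold_sum_mset image_mset.compositionality comp_def)
  finally show ?thesis by simp
qed

lemma set_block_differences:
  assumes "finite B" "B \<subseteq> carrier G"
  shows "set_mset (block_differences G B) \<subseteq> carrier G"
proof -
  have "finite {(x, y). x \<in> B \<and> y \<in> B \<and> x \<noteq> y}"
    by (rule finite_subset[of _ "B \<times> B"]) (use assms in auto)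
  then show ?thesis using assms(2) by (auto simp: block_differences_def)
qed

lemma set_list_of_differences:
  assumes "\<forall>B\<in>set Xs. finite B \<and> B \<subseteq> carrier G"
  shows "set_mset (list_of_differences G Xs) \<subseteq> carrier G"
  using assms
proof (induction Xs)
  case (Cons B Xs)
  then show ?case using set_block_differences[of B] by (auto simp: list_of_differences_def)
qed (simp add: list_of_differences_def)

lemma sum_list_squares_sign_char:
  assumes S: "subgroup S G" "card (rcosets S) = 2"
    and "\<forall>B\<in>set Xs. finite B \<and> B \<subseteq> carrier G \<and> card B = k"
  shows "(\<Sum>B\<leftarrow>Xs. (\<Sum>x\<in>B. sign_char S x)\<^sup>2)
       = int k * int (length Xs) + sum_mset (image_mset (sign_char S) (list_of_differences G Xs))"
  using assms(3)
proof (induction Xs)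
  case (Cons B Xs)
  then show ?case
    using square_sum_sign_char[OF S, of B]
    by (simp add: list_of_differences_def algebra_simps)
qed (simp add: list_of_differences_def)

lemma sum_sign_char_differences:
  assumes S: "subgroup S G" "card (rcosets S) = 2"
    and H: "subgroup H G" and fin: "finite (carrier G)"
    and rdf: "relative_difference_family G H k l Xs"
  shows "sum_mset (image_mset (sign_char S) (list_of_differences G Xs))
       = - int l * (\<Sum>h\<in>H. sign_char S h)"
proof -
  let ?M = "list_of_differences G Xs"
  note HG = subgroup.subset[OF H]
  have "set_mset ?M \<subseteq> carrier G"
    using rdf fin by (intro set_list_of_differences)
      (auto simp: relative_difference_family_def intro: finite_subset)
  then have "sum_mset (image_mset (sign_char S) ?M)
      = (\<Sum>g\<in>carrier G. int (count ?M g) * sign_char S g)"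
    by (rule sum_image_mset_eq_sum_count[OF fin])
  also have "\<dots> = (\<Sum>g\<in>carrier G - H. int (count ?M g) * sign_char S g)
                + (\<Sum>g\<in>H. int (count ?M g) * sign_char S g)"
    by (rule sum.subset_diff[OF HG fin])
  also have "(\<Sum>g\<in>H. int (count ?M g) * sign_char S g) = 0"
    using rdf by (intro sum.neutral) (auto simp: relative_difference_family_def not_in_iff)
  also have "(\<Sum>g\<in>carrier G - H. int (count ?M g) * sign_char S g)
      = (\<Sum>g\<in>carrier G - H. int l * sign_char S g)"
    using rdf by (intro sum.cong) (auto simp: relative_difference_family_def)
  also have "\<dots> = int l * ((\<Sum>g\<in>carrier G. sign_char S g) - (\<Sum>h\<in>H. sign_char S h))"
    by (simp add: sum_diff[OF fin HG] flip: sum_distrib_left)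
  also have "(\<Sum>g\<in>carrier G. sign_char S g) = 0"
    by (rule sum_sign_char_subgroup[OF S subgroup_self index_two_not_subset[OF S]])
  finally show ?thesis by simp
qed

end

theorem theorem5p3:
  fixes G :: "('a, 'b) monoid_scheme" (structure)
    and S H :: "'a set" and k l w n :: nat and Xs :: "'a set list"
  assumes "group G" and "finite (carrier G)"
    and "subgroup S G" and "card (rcosets S) = 2"
    and "subgroup H G" and "card H = w"
    and "k > 0" and "l > 0"
    and "relative_difference_family G H k l Xs" and "length Xs = n"
  shows "(H \<subseteq> S \<longrightarrow> is_sum_of_squares n (int k * int n - int l * int w)) \<and>
         (\<not> H \<subseteq> S \<longrightarrow> is_sum_of_squares n (int k * int n))"
proof -
  interpret group G by fact
  have "(\<Sum>i<n. (\<Sum>x\<in>Xs ! i. sign_char S x)\<^sup>2) = (\<Sum>B\<leftarrow>Xs. (\<Sum>x\<in>B. sign_char S x)\<^sup>2)"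
    using assms(10) by (simp add: sum_list_sum_nth atLeast0LessThan)
  also have "\<dots> = int k * int n + sum_mset (image_mset (sign_char S) (list_of_differences G Xs))"
    using sum_list_squares_sign_char[OF assms(3,4), of Xs k] assms(2,9,10)
    by (auto simp: relative_difference_family_def intro: finite_subset)
  also have "\<dots> = int k * int n - int l * (\<Sum>h\<in>H. sign_char S h)"
    by (simp add: sum_sign_char_differences[OF assms(3,4,5,2,9)])
  finally have squares:
    "is_sum_of_squares n (int k * int n - int l * (\<Sum>h\<in>H. sign_char S h))"
    unfolding is_sum_of_squares_def by metis
  have "(\<Sum>h\<in>H. sign_char S h) = int w" if "H \<subseteq> S"
  proof -
    have "(\<Sum>h\<in>H. sign_char S h) = (\<Sum>h\<in>H. 1)"
      using that by (intro sum.cong) (auto simp: sign_char_def)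
    then show ?thesis using assms(6) by simp
  qed
  moreover have "(\<Sum>h\<in>H. sign_char S h) = 0" if "\<not> H \<subseteq> S"
    by (rule sum_sign_char_subgroup[OF assms(3,4,5) that])
  ultimately show ?thesis using squares by (cases "H \<subseteq> S") simp_all
qed

end
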